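(* Let $(X,d,\mu)$ be a quasi-metric-measure space. If $(X,d)$ is totally bounded, then $\mu$ is integrable.
   Context: A quasi-metric space $(X,d)$ is a set $X$ with at least two elements and a function $d:X\times X\to[0,\infty)$ for which there are constants $C_0,C_1\in(0,\infty)$ such that for all $x,y,z\in X$: $d(x,y)=0$ iff $x=y$; $d(y,x)\le C_0 d(x,y)$; $d(x,y)\le C_1\max\{d(x,z),d(z,y)\}$ (symmetry is not required). Balls are $B_d(x,r):=\{y\in X:d(x,y)<r\}$. The topology $\tau_d$ consists of all $\mathcal O\subseteq X$ such that for each $x\in\mathcal O$ there is $r>0$ with $B_d(x,r)\subseteq\mathcal O$. Quasi-metrics $d,\rho$ are equivalent if $\kappa^{-1}\rho\le d\le\kappa\rho$ on $X\times X$ for some constant $\kappa>0$. A quasi-metric-measure space $(X,d,\mu)$ is a quasi-metric space with a nonnegative measure $\mu$ on a $\sigma$-algebra containing the Borel sets of $\tau_d$, such that all $d$-balls are measurable and $\mu(B_d(x,r))\in(0,\infty)$ for all $x\in X$, $r\in(0,\infty)$. $(X,d)$ is totally bounded if for every $\varepsilon>0$ it is covered by finitely many balls $B_d(x_i,\varepsilon)$. The measure $\mu$ is integrable if there is a quasi-metric $\rho$ on $X$ equivalent to $d$ such that for each fixed $r\in(0,\infty)$ the mapping $x\mapsto\mu(B_\rho(x,r))$ is well defined (i.e. $\rho$-balls are measurable), measurable, and $\int_X\frac{1}{\mu(B_\rho(x,r))}\,d\mu(x)<\infty$. *)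

theory Defs
  imports "HOL-Analysis.Analysis"
begin

definition quasi_metric_on :: "'a set \<Rightarrow> ('a \<Rightarrow> 'a \<Rightarrow> real) \<Rightarrow> bool" where
  "quasi_metric_on X d \<longleftrightarrow>
     (\<exists>x\<in>X. \<exists>y\<in>X. x \<noteq> y) \<and>
     (\<forall>x\<in>X. \<forall>y\<in>X. 0 \<le> d x y) \<and>
     (\<forall>x\<in>X. \<forall>y\<in>X. d x y = 0 \<longleftrightarrow> x = y) \<and>
     (\<exists>C0>0. \<forall>x\<in>X. \<forall>y\<in>X. d y x \<le> C0 * d x y) \<and>
     (\<exists>C1>0. \<forall>x\<in>X. \<forall>y\<in>X. \<forall>z\<in>X. d x y \<le> C1 * max (d x z) (d z y))"

definition qm_ball :: "'a set \<Rightarrow> ('a \<Rightarrow> 'a \<Rightarrow> real) \<Rightarrow> 'a \<Rightarrow> real \<Rightarrow> 'a set" where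
  "qm_ball X d x r = {y \<in> X. d x y < r}"

definition qm_topology :: "'a set \<Rightarrow> ('a \<Rightarrow> 'a \<Rightarrow> real) \<Rightarrow> 'a topology" where
  "qm_topology X d = topology (\<lambda>U. U \<subseteq> X \<and> (\<forall>x\<in>U. \<exists>r>0. qm_ball X d x r \<subseteq> U))"

lemma openin_qm_topology:
  "openin (qm_topology X d) U \<longleftrightarrow> U \<subseteq> X \<and> (\<forall>x\<in>U. \<exists>r>0. qm_ball X d x r \<subseteq> U)"
proof -
  have "istopology (\<lambda>U. U \<subseteq> X \<and> (\<forall>x\<in>U. \<exists>r>0. qm_ball X d x r \<subseteq> U))"
    unfolding istopology_def
  proof (intro conjI allI impI ballI)
    fix S T x
    assume S: "S \<subseteq> X \<and> (\<forall>x\<in>S. \<exists>r>0. qm_ball X d x r \<subseteq> S)"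
      and T: "T \<subseteq> X \<and> (\<forall>x\<in>T. \<exists>r>0. qm_ball X d x r \<subseteq> T)"
    show "S \<inter> T \<subseteq> X" using S by blast
    assume "x \<in> S \<inter> T"
    then obtain r s where "r > 0" "qm_ball X d x r \<subseteq> S" "s > 0" "qm_ball X d x s \<subseteq> T"
      using S T by blast
    then show "\<exists>r>0. qm_ball X d x r \<subseteq> S \<inter> T"
      by (intro exI[of _ "min r s"]) (auto simp: qm_ball_def)
  next
    fix K x
    assume K: "\<forall>S\<in>K. S \<subseteq> X \<and> (\<forall>x\<in>S. \<exists>r>0. qm_ball X d x r \<subseteq> S)"
    show "\<Union>K \<subseteq> X" using K by blast
    assume "x \<in> \<Union>K"
    then show "\<exists>r>0. qm_ball X d x r \<subseteq> \<Union>K" using K by (meson UnionE Union_upper order_trans)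
  qed
  then show ?thesis by (simp add: qm_topology_def topology_inverse')
qed

lemma topspace_qm_topology [simp]: "topspace (qm_topology X d) = X"
proof -
  have "openin (qm_topology X d) X"
    by (auto simp: openin_qm_topology qm_ball_def intro: exI[of _ 1])
  then show ?thesis
    by (meson openin_qm_topology openin_subset openin_topspace subset_antisym)
qed

definition qm_borel_sets :: "'a set \<Rightarrow> ('a \<Rightarrow> 'a \<Rightarrow> real) \<Rightarrow> 'a set set" where
  "qm_borel_sets X d = sigma_sets X {U. openin (qm_topology X d) U}"

definition qm_equivalent :: "'a set \<Rightarrow> ('a \<Rightarrow> 'a \<Rightarrow> real) \<Rightarrow> ('a \<Rightarrow> 'a \<Rightarrow> real) \<Rightarrow> bool" where
  "qm_equivalent X d \<rho> \<longleftrightarrow>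
     (\<exists>\<kappa>>0. \<forall>x\<in>X. \<forall>y\<in>X. inverse \<kappa> * \<rho> x y \<le> d x y \<and> d x y \<le> \<kappa> * \<rho> x y)"

definition quasi_metric_measure_space ::
    "'a set \<Rightarrow> ('a \<Rightarrow> 'a \<Rightarrow> real) \<Rightarrow> 'a measure \<Rightarrow> bool" where
  "quasi_metric_measure_space X d \<mu> \<longleftrightarrow>
     quasi_metric_on X d \<and>
     space \<mu> = X \<and>
     qm_borel_sets X d \<subseteq> sets \<mu> \<and>
     (\<forall>x\<in>X. \<forall>r>0. qm_ball X d x r \<in> sets \<mu> \<and>
        0 < emeasure \<mu> (qm_ball X d x r) \<and> emeasure \<mu> (qm_ball X d x r) < \<infinity>)"

definition qm_totally_bounded :: "'a set \<Rightarrow> ('a \<Rightarrow> 'a \<Rightarrow> real) \<Rightarrow> bool" where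
  "qm_totally_bounded X d \<longleftrightarrow>
     (\<forall>\<epsilon>>0. \<exists>F. finite F \<and> F \<subseteq> X \<and> X \<subseteq> (\<Union>x\<in>F. qm_ball X d x \<epsilon>))"

text \<open>
  The measurability of the \<open>\<rho>\<close>-balls has to be required explicitly, because
  \<^const>\<open>emeasure\<close> is \<open>0\<close> on non-measurable sets. The quotient below is taken in
  \<^typ>\<open>ennreal\<close>, where \<open>1 / 0 = \<infinity>\<close> and \<open>1 / \<infinity> = 0\<close>.
\<close>

definition qm_integrable_measure ::
    "'a set \<Rightarrow> ('a \<Rightarrow> 'a \<Rightarrow> real) \<Rightarrow> 'a measure \<Rightarrow> bool" where
  "qm_integrable_measure X d \<mu> \<longleftrightarrow>
     (\<exists>\<rho>. quasi_metric_on X \<rho> \<and> qm_equivalent X d \<rho> \<and>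
        (\<forall>r>0. (\<forall>x\<in>X. qm_ball X \<rho> x r \<in> sets \<mu>) \<and>
               (\<lambda>x. emeasure \<mu> (qm_ball X \<rho> x r)) \<in> borel_measurable \<mu> \<and>
               (\<integral>\<^sup>+x. 1 / emeasure \<mu> (qm_ball X \<rho> x r) \<partial>\<mu>) < \<infinity>))"

end

theory Submission
  imports Defs
begin

text \<open>
  The equivalent quasi-metric can be chosen so coarse that everything becomes a finite
  computation. Total boundedness provides, for each \<open>k\<close>, a finite family \<open>N k\<close> of measurable
  \<open>d\<close>-balls of radius comparable to \<open>2\<^sup>-\<^sup>k\<close> such that any two points at distance less than
  \<open>2\<^sup>-\<^sup>k\<close> lie in a common member of \<open>N k\<close>, and points in a common member are at distance
  \<open>O(2\<^sup>-\<^sup>k)\<close> (\<open>totally_bounded_dyadic_cover\<close>). Put \<open>\<rho> x y = 2\<^sup>-\<^sup>k\<close> for the first level \<open>k\<close> at which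
  no member of \<open>N k\<close> contains both \<open>x\<close> and \<open>y\<close>. Since \<open>d\<close> is bounded, \<open>\<rho>\<close> is equivalent to
  \<open>d\<close> (\<open>cover_dist_equivalent\<close>).

  The ball \<open>B\<^sub>\<rho>(x,r)\<close> only depends on the finitely many levels with \<open>2\<^sup>-\<^sup>k \<ge> r\<close>, hence only on
  which of finitely many measurable sets contain \<open>x\<close>. So the balls of radius \<open>r\<close> form a
  finite collection of measurable sets, and \<open>x \<mapsto> \<mu>(B\<^sub>\<rho>(x,r))\<close> is a simple function. Each
  such ball contains a \<open>d\<close>-ball, so its measure is positive and \<open>1 / \<mu>(B\<^sub>\<rho>(x,r))\<close> is bounded;
  as \<open>X\<close> is itself contained in a \<open>d\<close>-ball, \<open>\<mu>(X)\<close> is finite and the integral converges.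
\<close>

section \<open>Quasi-metrics up to equivalence\<close>

lemma qm_equivalent_quasi_metric_on:
  assumes d: "quasi_metric_on X d" and eq: "qm_equivalent X d \<rho>"
  shows "quasi_metric_on X \<rho>"
proof -
  obtain K where K: "K > 0" and
    eqK: "\<And>x y. x \<in> X \<Longrightarrow> y \<in> X \<Longrightarrow> inverse K * \<rho> x y \<le> d x y \<and> d x y \<le> K * \<rho> x y"
    using eq unfolding qm_equivalent_def by blast
  have up: "\<rho> x y \<le> K * d x y" and lo: "d x y \<le> K * \<rho> x y" if "x \<in> X" "y \<in> X" for x y
    using eqK[OF that] K by (simp_all add: field_simps)
  obtain C0 where C0: "C0 > 0" "\<And>x y. x \<in> X \<Longrightarrow> y \<in> X \<Longrightarrow> d y x \<le> C0 * d x y"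
    using d unfolding quasi_metric_on_def by blast
  obtain C1 where C1: "C1 > 0"
    "\<And>x y z. x \<in> X \<Longrightarrow> y \<in> X \<Longrightarrow> z \<in> X \<Longrightarrow> d x y \<le> C1 * max (d x z) (d z y)"
    using d unfolding quasi_metric_on_def by blast
  have d_nonneg: "0 \<le> d x y" and d_zero: "d x y = 0 \<longleftrightarrow> x = y" if "x \<in> X" "y \<in> X" for x y
    using d that unfolding quasi_metric_on_def by auto
  have nonneg: "0 \<le> \<rho> x y" if "x \<in> X" "y \<in> X" for x y
    using lo[OF that] d_nonneg[OF that] K by (meson order_trans zero_le_mult_iff not_le)
  have zero: "\<rho> x y = 0 \<longleftrightarrow> x = y" if "x \<in> X" "y \<in> X" for x y
    using up[OF that] lo[OF that] nonneg[OF that] d_nonneg[OF that] d_zero[OF that] by force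
  have sym: "\<rho> y x \<le> (K * C0 * K) * \<rho> x y" if "x \<in> X" "y \<in> X" for x y
  proof -
    have "\<rho> y x \<le> K * d y x" using up that by blast
    also have "\<dots> \<le> K * (C0 * d x y)" using C0(2) that K by simp
    also have "\<dots> \<le> K * (C0 * (K * \<rho> x y))" using lo[OF that] K C0(1) by simp
    finally show ?thesis by (simp add: mult_ac)
  qed
  have tri: "\<rho> x y \<le> (K * C1 * K) * max (\<rho> x z) (\<rho> z y)" if "x \<in> X" "y \<in> X" "z \<in> X" for x y z
  proof -
    have "\<rho> x y \<le> K * d x y" using up that by blast
    also have "\<dots> \<le> K * (C1 * max (d x z) (d z y))" using C1(2) that K by simp
    also have "max (d x z) (d z y) \<le> K * max (\<rho> x z) (\<rho> z y)"
    proof -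
      have "K * \<rho> x z \<le> K * max (\<rho> x z) (\<rho> z y)" "K * \<rho> z y \<le> K * max (\<rho> x z) (\<rho> z y)"
        using K by simp_all
      then show ?thesis using lo[of x z] lo[of z y] that by fastforce
    qed
    then have "K * (C1 * max (d x z) (d z y)) \<le> K * (C1 * (K * max (\<rho> x z) (\<rho> z y)))"
      using K C1(1) by simp
    finally show ?thesis by (simp add: mult_ac)
  qed
  have pos: "K * C0 * K > 0" "K * C1 * K > 0" using K C0(1) C1(1) by simp_all
  show ?thesis
    unfolding quasi_metric_on_def
  proof (intro conjI)
    show "\<exists>x\<in>X. \<exists>y\<in>X. x \<noteq> y" using d unfolding quasi_metric_on_def by (elim conjE)
    show "\<forall>x\<in>X. \<forall>y\<in>X. 0 \<le> \<rho> x y" using nonneg by simp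
    show "\<forall>x\<in>X. \<forall>y\<in>X. \<rho> x y = 0 \<longleftrightarrow> x = y" using zero by simp
    show "\<exists>c>0. \<forall>x\<in>X. \<forall>y\<in>X. \<rho> y x \<le> c * \<rho> x y"
      using pos(1) sym by (intro exI[of _ "K * C0 * K"] conjI ballI)
    show "\<exists>c>0. \<forall>x\<in>X. \<forall>y\<in>X. \<forall>z\<in>X. \<rho> x y \<le> c * max (\<rho> x z) (\<rho> z y)"
      using pos(2) tri by (intro exI[of _ "K * C1 * K"] conjI ballI)
  qed
qed

lemma qm_equivalent_ball_subset:
  assumes "qm_equivalent X d \<rho>" "x \<in> X" "r > 0"
  obtains s where "s > 0" "qm_ball X d x s \<subseteq> qm_ball X \<rho> x r"
proof -
  obtain K where K: "K > 0" "\<And>y. y \<in> X \<Longrightarrow> inverse K * \<rho> x y \<le> d x y"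
    using assms(1,2) unfolding qm_equivalent_def by blast
  have "qm_ball X d x (inverse K * r) \<subseteq> qm_ball X \<rho> x r"
  proof
    fix y assume "y \<in> qm_ball X d x (inverse K * r)"
    then have y: "y \<in> X" "d x y < inverse K * r" unfolding qm_ball_def by auto
    then have "inverse K * \<rho> x y < inverse K * r" using K(2)[of y] by linarith
    then show "y \<in> qm_ball X \<rho> x r" using K(1) y(1) by (simp add: qm_ball_def)
  qed
  moreover have "inverse K * r > 0" using K(1) assms(3) by simp
  ultimately show ?thesis using that by blast
qed

lemma totally_bounded_eq_ball:
  assumes d: "quasi_metric_on X d" and tb: "qm_totally_bounded X d" and p: "p \<in> X"
  obtains R where "R > 0" "X = qm_ball X d p R"
proof -
  obtain C1 where C1: "C1 > 0"
    "\<And>x y z. x \<in> X \<Longrightarrow> y \<in> X \<Longrightarrow> z \<in> X \<Longrightarrow> d x y \<le> C1 * max (d x z) (d z y)"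
    using d unfolding quasi_metric_on_def by blast
  have d_nonneg: "0 \<le> d x y" if "x \<in> X" "y \<in> X" for x y
    using d that unfolding quasi_metric_on_def by auto
  obtain F where F: "finite F" "F \<subseteq> X" "X \<subseteq> (\<Union>a\<in>F. qm_ball X d a 1)"
    using tb unfolding qm_totally_bounded_def by (metis zero_less_one)
  \<comment> \<open>Any upper bound for the distances from \<open>p\<close> to the finite net would do.\<close>
  define s where "s = (\<Sum>a\<in>F. d p a)"
  have s: "0 \<le> s" unfolding s_def using d_nonneg p F(2) by (auto intro!: sum_nonneg)
  have "d p x < C1 * (s + 1) + 1" if x: "x \<in> X" for x
  proof -
    obtain a where a: "a \<in> F" "d a x < 1" using F(3) x unfolding qm_ball_def by auto
    have "d p a \<le> s" unfolding s_def
      using F(1,2) a(1) d_nonneg p by (intro member_le_sum) auto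
    then have "C1 * max (d p a) (d a x) \<le> C1 * (s + 1)" using a(2) s C1(1) by simp
    then show ?thesis using C1(2)[of p x a] p x a(1) F(2) by force
  qed
  then have "X = qm_ball X d p (C1 * (s + 1) + 1)" unfolding qm_ball_def by auto
  moreover have "C1 * (s + 1) + 1 > 0" using C1(1) s by (simp add: add_nonneg_pos)
  ultimately show ?thesis using that by blast
qed

section \<open>The distance defined by a sequence of covers\<close>

definition share_member :: "'a set set \<Rightarrow> 'a \<Rightarrow> 'a \<Rightarrow> bool" where
  "share_member N x y \<longleftrightarrow> (\<exists>B\<in>N. x \<in> B \<and> y \<in> B)"

text \<open>
  The covers need not refine each other, so sharing a member at level \<open>k\<close> says nothing about
  lower levels. Taking the first level of separation, so that \<open>\<rho> x y\<close> is the largest \<open>2\<^sup>-\<^sup>k\<close> over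
  all separating levels, makes small distance equivalent to contact at \<^emph>\<open>all\<close> of the
  finitely many coarse levels.
\<close>

definition cover_dist :: "(nat \<Rightarrow> 'a set set) \<Rightarrow> 'a \<Rightarrow> 'a \<Rightarrow> real" where
  "cover_dist N x y = (if x = y then 0 else (1/2) ^ (LEAST k. \<not> share_member (N k) x y))"

lemma dyadic_less_exists:
  fixes C t :: real
  assumes "0 < C" "0 < t"
  obtains k where "C * (1/2) ^ k < t"
  using real_arch_pow_inv[of "t / C" "1/2"] assms by (auto simp: field_simps)

lemma finite_dyadic_ge: "0 < (r::real) \<Longrightarrow> finite {k. r \<le> (1/2) ^ k}"
proof -
  assume "0 < r"
  then obtain n where n: "1 * (1/2) ^ n < r" using dyadic_less_exists[of 1 r] by auto
  have "{k. r \<le> (1/2) ^ k} \<subseteq> {..n}"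
  proof
    fix k assume k: "k \<in> {k. r \<le> (1/2) ^ k}"
    show "k \<in> {..n}"
    proof (rule ccontr)
      assume "k \<notin> {..n}"
      then have "(1/2::real) ^ k \<le> (1/2) ^ n" by (intro power_decreasing) auto
      then have "r \<le> (1/2) ^ n" using k by (metis mem_Collect_eq order_trans)
      then show False using n by simp
    qed
  qed
  then show ?thesis using finite_subset by blast
qed

lemma coarse_covers_separate:
  assumes d: "quasi_metric_on X d" and C: "0 < C"
    and coarse: "\<And>k. share_member (N k) x y \<Longrightarrow> d x y \<le> C * (1/2) ^ k"
    and xy: "x \<in> X" "y \<in> X" "x \<noteq> y"
  shows "\<exists>k. \<not> share_member (N k) x y"
proof -
  have "0 \<le> d x y" "d x y \<noteq> 0" using d xy unfolding quasi_metric_on_def by auto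
  then have "0 < d x y" by simp
  then obtain k where "C * (1/2) ^ k < d x y" using dyadic_less_exists[OF C] by blast
  then show ?thesis using coarse by (meson not_le)
qed

text \<open>
  Separation at level \<open>k\<close> forces \<open>d x y \<ge> 2\<^sup>-\<^sup>k\<close>, which bounds \<open>\<rho>\<close> by \<open>d\<close>. For the
  reverse bound, contact at the level just before the first separation gives
  \<open>d x y \<le> C * 2\<^sup>1\<^sup>-\<^sup>k\<close>; when \<open>k = 0\<close> there is no such level, and boundedness of \<open>d\<close> is used.
\<close>

lemma cover_dist_equivalent:
  assumes d: "quasi_metric_on X d"
    and bounded: "\<And>x y. x \<in> X \<Longrightarrow> y \<in> X \<Longrightarrow> d x y \<le> M"
    and fine: "\<And>k x y. x \<in> X \<Longrightarrow> y \<in> X \<Longrightarrow> d x y < (1/2) ^ k \<Longrightarrow> share_member (N k) x y"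
    and C: "0 < C"
    and coarse: "\<And>k x y. x \<in> X \<Longrightarrow> y \<in> X \<Longrightarrow> share_member (N k) x y \<Longrightarrow> d x y \<le> C * (1/2) ^ k"
  shows "qm_equivalent X d (cover_dist N)"
proof -
  have d_nonneg: "0 \<le> d x y" and d_zero: "d x y = 0 \<longleftrightarrow> x = y" if "x \<in> X" "y \<in> X" for x y
    using d that unfolding quasi_metric_on_def by auto
  define K where "K = max 1 (max M (2 * C))"
  have K: "1 \<le> K" "M \<le> K" "2 * C \<le> K" unfolding K_def by auto
  have "inverse K * cover_dist N x y \<le> d x y \<and> d x y \<le> K * cover_dist N x y"
    if xy: "x \<in> X" "y \<in> X" for x y
  proof (cases "x = y")
    case True
    then show ?thesis using d_zero[OF xy] by (simp add: cover_dist_def)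
  next
    case False
    define k where "k = (LEAST k. \<not> share_member (N k) x y)"
    have \<rho>: "cover_dist N x y = (1/2) ^ k" using False by (simp add: cover_dist_def k_def)
    have sep: "\<not> share_member (N k) x y"
      unfolding k_def
      using coarse_covers_separate[where N = N, OF d C coarse[OF xy] xy False] by (rule LeastI_ex)
    have le: "cover_dist N x y \<le> d x y" using sep fine[OF xy] \<rho> by force
    have "inverse K * cover_dist N x y \<le> 1 * cover_dist N x y"
      using K(1) \<rho> by (intro mult_right_mono) (auto simp: inverse_le_1_iff)
    moreover have "d x y \<le> K * cover_dist N x y"
    proof (cases k)
      case 0
      then show ?thesis using bounded[OF xy] K(2) \<rho> by simp
    next
      case (Suc j)
      have "share_member (N j) x y"
        using not_less_Least[of j "\<lambda>k. \<not> share_member (N k) x y"] Suc k_def by simp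
      then have "d x y \<le> (2 * C) * (1/2) ^ k" using coarse[OF xy] Suc by simp
      also have "\<dots> \<le> K * (1/2) ^ k" using K(3) by (intro mult_right_mono) auto
      finally show ?thesis using \<rho> by simp
    qed
    ultimately show ?thesis using le by simp
  qed
  then show ?thesis
    unfolding qm_equivalent_def using K(1) by (intro exI[of _ K]) auto
qed

lemma cover_dist_less_iff:
  assumes r: "0 < r"
    and refl: "\<And>k. share_member (N k) x x"
    and separated: "x \<noteq> y \<Longrightarrow> \<exists>k. \<not> share_member (N k) x y"
  shows "cover_dist N x y < r \<longleftrightarrow> (\<forall>k. r \<le> (1/2) ^ k \<longrightarrow> share_member (N k) x y)"
proof (cases "x = y")
  case True
  then show ?thesis using r refl by (simp add: cover_dist_def)
next
  case False
  define k where "k = (LEAST k. \<not> share_member (N k) x y)"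
  have \<rho>: "cover_dist N x y = (1/2) ^ k" using False by (simp add: cover_dist_def k_def)
  have sep: "\<not> share_member (N k) x y"
    unfolding k_def using separated[OF False] by (rule LeastI_ex)
  have "share_member (N j) x y" if "(1/2) ^ k < r" "r \<le> (1/2) ^ j" for j
  proof (rule ccontr)
    assume "\<not> share_member (N j) x y"
    then have "k \<le> j" unfolding k_def by (rule Least_le)
    then have "(1/2::real) ^ j \<le> (1/2) ^ k" by (intro power_decreasing) auto
    then show False using that by linarith
  qed
  then show ?thesis using \<rho> sep by force
qed

section \<open>Finite dyadic covers of a totally bounded space\<close>

text \<open>
  Enlarging the radius of the covering balls by the factor \<open>C1\<close> is what makes a ball
  around a net point contain, with each point of the original smaller ball, the whole
  \<open>2\<^sup>-\<^sup>k\<close>-neighbourhood of that point.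
\<close>

lemma totally_bounded_dyadic_cover:
  assumes d: "quasi_metric_on X d" and tb: "qm_totally_bounded X d"
  obtains C :: real and N where "0 < C"
    "\<And>k. finite (N k)"
    "\<And>k B. B \<in> N k \<Longrightarrow> \<exists>a\<in>X. \<exists>r>0. B = qm_ball X d a r"
    "\<And>k x y. x \<in> X \<Longrightarrow> y \<in> X \<Longrightarrow> d x y < (1/2) ^ k \<Longrightarrow> share_member (N k) x y"
    "\<And>k x y. x \<in> X \<Longrightarrow> y \<in> X \<Longrightarrow> share_member (N k) x y \<Longrightarrow> d x y \<le> C * (1/2) ^ k"
proof -
  have d_nonneg: "0 \<le> d x y" if "x \<in> X" "y \<in> X" for x y
    using d that unfolding quasi_metric_on_def by auto
  obtain C0 where C0: "C0 > 0" "\<And>x y. x \<in> X \<Longrightarrow> y \<in> X \<Longrightarrow> d y x \<le> C0 * d x y"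
    using d unfolding quasi_metric_on_def by blast
  obtain C1' where C1': "C1' > 0"
    "\<And>x y z. x \<in> X \<Longrightarrow> y \<in> X \<Longrightarrow> z \<in> X \<Longrightarrow> d x y \<le> C1' * max (d x z) (d z y)"
    using d unfolding quasi_metric_on_def by blast
  \<comment> \<open>A constant at least \<open>1\<close>, so that the enlarged balls contain the original ones.\<close>
  define C1 where "C1 = max 1 C1'"
  have C1: "1 \<le> C1" "0 < C1" unfolding C1_def by auto
  have tri: "d x y \<le> C1 * max (d x z) (d z y)" if "x \<in> X" "y \<in> X" "z \<in> X" for x y z
  proof -
    have "0 \<le> max (d x z) (d z y)" using d_nonneg that by (simp add: le_max_iff_disj)
    then have "C1' * max (d x z) (d z y) \<le> C1 * max (d x z) (d z y)"
      unfolding C1_def by (intro mult_right_mono) auto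
    then show ?thesis using C1'(2) that by force
  qed
  have "\<forall>k. \<exists>F. finite F \<and> F \<subseteq> X \<and> X \<subseteq> (\<Union>a\<in>F. qm_ball X d a ((1/2) ^ k))"
    using tb unfolding qm_totally_bounded_def by simp
  then obtain F where
    F: "\<And>k. finite (F k)" "\<And>k. F k \<subseteq> X" "\<And>k. X \<subseteq> (\<Union>a\<in>F k. qm_ball X d a ((1/2) ^ k))"
    by metis
  define N where "N k = (\<lambda>a. qm_ball X d a (C1 * (1/2) ^ k)) ` F k" for k
  show ?thesis
  proof (rule that[of "C1 * ((C0 + 1) * C1)" N])
    show "0 < C1 * ((C0 + 1) * C1)" using C0(1) C1 by simp
    show "finite (N k)" for k unfolding N_def using F(1) by simp
    show "\<exists>a\<in>X. \<exists>r>0. B = qm_ball X d a r" if B: "B \<in> N k" for k B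
    proof -
      obtain a where a: "a \<in> F k" "B = qm_ball X d a (C1 * (1/2) ^ k)"
        using B unfolding N_def by blast
      have "0 < C1 * (1/2) ^ k" using C1 by simp
      then show ?thesis using a F(2) by blast
    qed
    show "share_member (N k) x y" if xy: "x \<in> X" "y \<in> X" "d x y < (1/2) ^ k" for k x y
    proof -
      obtain a where a: "a \<in> F k" "d a x < (1/2) ^ k"
        using F(3)[of k] xy(1) unfolding qm_ball_def by auto
      have aX: "a \<in> X" using a(1) F(2) by blast
      have "1 * (1/2::real) ^ k \<le> C1 * (1/2) ^ k" using C1 by (intro mult_right_mono) auto
      then have "d a x < C1 * (1/2) ^ k" using a(2) by linarith
      moreover have "C1 * max (d a x) (d x y) < C1 * (1/2) ^ k" using a(2) xy(3) C1 by simp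
      then have "d a y < C1 * (1/2) ^ k" using tri[OF aX xy(2) xy(1)] by linarith
      ultimately show ?thesis
        unfolding share_member_def N_def using a(1) xy by (auto simp: qm_ball_def)
    qed
    show "d x y \<le> C1 * ((C0 + 1) * C1) * (1/2) ^ k"
      if xy: "x \<in> X" "y \<in> X" and share: "share_member (N k) x y" for k x y
    proof -
      define e where "e = C1 * (1/2) ^ k"
      have e: "0 < e" unfolding e_def using C1 by simp
      obtain a where a: "a \<in> X" "d a x < e" "d a y < e"
        using share F(2)[of k] unfolding share_member_def N_def qm_ball_def e_def by auto
      have "d x a \<le> C0 * e"
        using C0(2)[OF a(1) xy(1)] a(2) C0(1)
        by (meson less_imp_le mult_left_mono order_trans)
      moreover have "0 \<le> C0 * e" using C0(1) e by simp
      ultimately have "max (d x a) (d a y) \<le> (C0 + 1) * e" using a(3) e by (simp add: algebra_simps)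
      then have "C1 * max (d x a) (d a y) \<le> C1 * ((C0 + 1) * e)" using C1 by simp
      then have "d x y \<le> C1 * ((C0 + 1) * e)" using tri[OF xy a(1)] by linarith
      then show ?thesis unfolding e_def by (simp add: mult_ac)
    qed
  qed
qed

section \<open>Functions of a finite membership pattern\<close>

text \<open>
  Anything that depends on \<open>x\<close> only through its membership pattern is therefore a simple
  function of \<open>x\<close>; this is how a set-valued map such as \<open>x \<mapsto> B\<^sub>\<rho>(x,r)\<close> can be composed with \<open>\<mu>\<close>
  without a \<open>\<sigma>\<close>-algebra on sets.
\<close>

lemma simple_function_membership_pattern:
  assumes fin: "finite A" and meas: "A \<subseteq> sets M"
  shows "simple_function M (\<lambda>x. {B \<in> A. x \<in> B})"
  unfolding simple_function_def
proof (intro conjI ballI)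
  have "(\<lambda>x. {B \<in> A. x \<in> B}) ` space M \<subseteq> Pow A" by auto
  then show "finite ((\<lambda>x. {B \<in> A. x \<in> B}) ` space M)" using fin finite_subset by blast
next
  fix Q assume "Q \<in> (\<lambda>x. {B \<in> A. x \<in> B}) ` space M"
  then have "Q \<subseteq> A" by auto
  then have "(\<lambda>x. {B \<in> A. x \<in> B}) -` {Q} \<inter> space M
      = {x \<in> space M. \<forall>B\<in>A. x \<in> B \<longleftrightarrow> B \<in> Q}" by auto
  also have "\<dots> \<in> sets M"
  proof (rule sets.sets_Collect_finite_All)
    show "{x \<in> space M. x \<in> B \<longleftrightarrow> B \<in> Q} \<in> sets M" if "B \<in> A" for B
    proof (cases "B \<in> Q")
      case True
      have B: "B \<in> sets M" using that meas by (rule subsetD[rotated])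
      have "{x \<in> space M. x \<in> B \<longleftrightarrow> B \<in> Q} = B"
        using True sets.sets_into_space[OF B] by blast
      then show ?thesis using B by simp
    next
      case False
      then have "{x \<in> space M. x \<in> B \<longleftrightarrow> B \<in> Q} = space M - B" by auto
      then show ?thesis using that meas by auto
    qed
    show "finite A" by (rule fin)
  qed
  finally show "(\<lambda>x. {B \<in> A. x \<in> B}) -` {Q} \<inter> space M \<in> sets M" .
qed

lemma nn_integral_simple_function_finite:
  fixes f :: "'a \<Rightarrow> ennreal"
  assumes f: "simple_function M f" and fin: "emeasure M (space M) < \<infinity>"
    and f_fin: "\<And>x. x \<in> space M \<Longrightarrow> f x < \<infinity>"
  shows "(\<integral>\<^sup>+x. f x \<partial>M) < \<infinity>"
proof -
  define c where "c = (\<Sum>v\<in>f ` space M. v)"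
  have img: "finite (f ` space M)" using f unfolding simple_function_def by blast
  have c: "c < \<infinity>" unfolding c_def using img f_fin by simp
  have "(\<integral>\<^sup>+x. f x \<partial>M) \<le> (\<integral>\<^sup>+x. c \<partial>M)"
    unfolding c_def using img by (intro nn_integral_mono member_le_sum) auto
  also have "\<dots> = c * emeasure M (space M)" by simp
  also have "\<dots> < \<infinity>" using c fin by (simp add: ennreal_mult_less_top)
  finally show ?thesis .
qed

section \<open>Integrability\<close>

theorem proposition3p18:
  fixes X :: "'a set" and d :: "'a \<Rightarrow> 'a \<Rightarrow> real" and \<mu> :: "'a measure"
  assumes "quasi_metric_measure_space X d \<mu>"
    and "qm_totally_bounded X d"
  shows "qm_integrable_measure X d \<mu>"
proof -
  have d: "quasi_metric_on X d" and space: "space \<mu> = X"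
    and ball: "\<And>x r. x \<in> X \<Longrightarrow> 0 < r \<Longrightarrow> qm_ball X d x r \<in> sets \<mu>"
    and ball_pos: "\<And>x r. x \<in> X \<Longrightarrow> 0 < r \<Longrightarrow> 0 < emeasure \<mu> (qm_ball X d x r)"
    and ball_fin: "\<And>x r. x \<in> X \<Longrightarrow> 0 < r \<Longrightarrow> emeasure \<mu> (qm_ball X d x r) < \<infinity>"
    using assms(1) unfolding quasi_metric_measure_space_def by auto
  have d_zero: "d x x = 0" if "x \<in> X" for x
    using d that unfolding quasi_metric_on_def by auto
  obtain p where p: "p \<in> X" using d unfolding quasi_metric_on_def by blast
  obtain R where R: "R > 0" "X = qm_ball X d p R"
    using totally_bounded_eq_ball[OF d assms(2) p] .
  have fin: "emeasure \<mu> (space \<mu>) < \<infinity>" using ball_fin[OF p R(1)] R(2) space by simp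
  obtain M where bounded: "\<And>x y. x \<in> X \<Longrightarrow> y \<in> X \<Longrightarrow> d x y \<le> M"
  proof -
    obtain C0 where C0: "C0 > 0" "\<And>x y. x \<in> X \<Longrightarrow> y \<in> X \<Longrightarrow> d y x \<le> C0 * d x y"
      using d unfolding quasi_metric_on_def by blast
    obtain C1 where C1: "C1 > 0"
      "\<And>x y z. x \<in> X \<Longrightarrow> y \<in> X \<Longrightarrow> z \<in> X \<Longrightarrow> d x y \<le> C1 * max (d x z) (d z y)"
      using d unfolding quasi_metric_on_def by blast
    have "d x y \<le> C1 * max (C0 * R) R" if xy: "x \<in> X" "y \<in> X" for x y
    proof -
      have px: "d p z < R" if "z \<in> X" for z using that R(2) unfolding qm_ball_def by blast
      have "C0 * d p x \<le> C0 * R" using px[OF xy(1)] C0(1) by simp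
      then have "d x p \<le> C0 * R" using C0(2)[OF p xy(1)] by linarith
      then have "max (d x p) (d p y) \<le> max (C0 * R) R" using px[OF xy(2)] by auto
      then have "C1 * max (d x p) (d p y) \<le> C1 * max (C0 * R) R" using C1(1) by simp
      then show ?thesis using C1(2)[OF xy p] by linarith
    qed
    then show ?thesis using that by blast
  qed
  obtain C :: real and N where C: "0 < C" and N_fin: "\<And>k. finite (N k)"
    and N_ball: "\<And>k B. B \<in> N k \<Longrightarrow> \<exists>a\<in>X. \<exists>r>0. B = qm_ball X d a r"
    and fine: "\<And>k x y. x \<in> X \<Longrightarrow> y \<in> X \<Longrightarrow> d x y < (1/2) ^ k \<Longrightarrow> share_member (N k) x y"
    and coarse: "\<And>k x y. x \<in> X \<Longrightarrow> y \<in> X \<Longrightarrow> share_member (N k) x y \<Longrightarrow> d x y \<le> C * (1/2) ^ k"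
    by (rule totally_bounded_dyadic_cover[OF d assms(2)]) blast
  have N_sets: "N k \<subseteq> sets \<mu>" for k using N_ball ball by blast
  define \<rho> where "\<rho> = cover_dist N"
  have eq: "qm_equivalent X d \<rho>"
    unfolding \<rho>_def using d bounded fine C coarse by (rule cover_dist_equivalent)
  have separated: "\<exists>k. \<not> share_member (N k) x y" if "x \<in> X" "y \<in> X" "x \<noteq> y" for x y
    by (rule coarse_covers_separate[where N = N, OF d C coarse[OF that(1,2)] that])
  have refl: "share_member (N k) x x" if "x \<in> X" for k x
    using fine that d_zero by simp
  have "(\<forall>x\<in>X. qm_ball X \<rho> x r \<in> sets \<mu>) \<and>
      (\<lambda>x. emeasure \<mu> (qm_ball X \<rho> x r)) \<in> borel_measurable \<mu> \<and>
      (\<integral>\<^sup>+x. 1 / emeasure \<mu> (qm_ball X \<rho> x r) \<partial>\<mu>) < \<infinity>" if r: "r > 0" for r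
  proof -
    define L where "L = {k. r \<le> (1/2) ^ k}"
    define A where "A = (\<Union>k\<in>L. N k)"
    have L_fin: "finite L" unfolding L_def using finite_dyadic_ge[OF r] .
    have A: "finite A" "A \<subseteq> sets \<mu>" unfolding A_def using L_fin N_fin N_sets by auto
    \<comment> \<open>The \<open>\<rho>\<close>-ball of radius \<open>r\<close>, as a function of the membership pattern \<open>Q\<close> of its centre.
      It makes sense for every \<open>Q\<close>, and its measurability is clear from the formula.\<close>
    define ball_of where "ball_of Q = {y \<in> X. \<forall>k\<in>L. \<exists>B\<in>N k \<inter> Q. y \<in> B}" for Q
    have ball_eq: "qm_ball X \<rho> x r = ball_of {B \<in> A. x \<in> B}" if x: "x \<in> X" for x
    proof -
      have "\<rho> x y < r \<longleftrightarrow> (\<forall>k\<in>L. share_member (N k) x y)" if "y \<in> X" for y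
        unfolding \<rho>_def L_def using cover_dist_less_iff[OF r refl[OF x] separated[OF x that]] by simp
      then show ?thesis
        unfolding qm_ball_def ball_of_def share_member_def A_def by fastforce
    qed
    have "ball_of Q \<in> sets \<mu>" for Q
    proof -
      have "{y \<in> space \<mu>. \<forall>k\<in>L. \<exists>B\<in>N k \<inter> Q. y \<in> B} \<in> sets \<mu>"
      proof (rule sets.sets_Collect_finite_All[OF _ L_fin], rule sets.sets_Collect_finite_Ex)
        show "finite (N k \<inter> Q)" for k using N_fin by simp
        show "{y \<in> space \<mu>. y \<in> B} \<in> sets \<mu>" if "B \<in> N k \<inter> Q" for k B
        proof -
          have "B \<in> sets \<mu>" using that N_sets by blast
          then have "{y \<in> space \<mu>. y \<in> B} = B" using sets.sets_into_space[of B \<mu>] by blast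
          then show ?thesis using \<open>B \<in> sets \<mu>\<close> by simp
        qed
      qed
      then show ?thesis unfolding ball_of_def space .
    qed
    then have meas: "qm_ball X \<rho> x r \<in> sets \<mu>" if "x \<in> X" for x using ball_eq[OF that] by simp
    have simple: "simple_function \<mu> (\<lambda>x. h (qm_ball X \<rho> x r))" for h :: "'a set \<Rightarrow> ennreal"
    proof -
      have "simple_function \<mu> (\<lambda>x. h (ball_of {B \<in> A. x \<in> B}))"
        by (rule simple_function_compose1[OF simple_function_membership_pattern[OF A]])
      then show ?thesis
        by (rule simple_function_cong[THEN iffD1, rotated]) (simp add: ball_eq space)
    qed
    have pos: "0 < emeasure \<mu> (qm_ball X \<rho> x r)" if x: "x \<in> X" for x
    proof -
      obtain s where s: "s > 0" "qm_ball X d x s \<subseteq> qm_ball X \<rho> x r"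
        using qm_equivalent_ball_subset[OF eq x r] .
      have "0 < emeasure \<mu> (qm_ball X d x s)" using ball_pos[OF x s(1)] .
      also have "\<dots> \<le> emeasure \<mu> (qm_ball X \<rho> x r)" using s(2) meas[OF x] by (rule emeasure_mono)
      finally show ?thesis .
    qed
    have "(\<integral>\<^sup>+x. 1 / emeasure \<mu> (qm_ball X \<rho> x r) \<partial>\<mu>) < \<infinity>"
    proof (rule nn_integral_simple_function_finite[OF _ fin])
      show "simple_function \<mu> (\<lambda>x. 1 / emeasure \<mu> (qm_ball X \<rho> x r))"
        using simple[of "\<lambda>S. 1 / emeasure \<mu> S"] .
      show "1 / emeasure \<mu> (qm_ball X \<rho> x r) < \<infinity>" if "x \<in> space \<mu>" for x
        using pos[of x] that space by (auto simp: ennreal_divide_eq_top_iff less_top[symmetric])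
    qed
    then show ?thesis
      using meas borel_measurable_simple_function[OF simple[of "emeasure \<mu>"]] by blast
  qed
  then show ?thesis
    unfolding qm_integrable_measure_def
    using eq qm_equivalent_quasi_metric_on[OF d eq] by blast
qed

end
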